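(* Let $u$ be an integral radial solution of $S_k(D^2u)=g(u)$ in $B_1$. Then $u\in C^2(0,1]$.
   Context: $n$ is a positive integer, $k\in\{1,\dots,n\}$, $B_1$ is the unit ball of $\mathbb{R}^n$, $c_{n,k}=\binom{n}{k}/n$, $g$ is a positive $C^1$ nonlinearity, and $S_k(D^2u)$ is the $k$-Hessian operator, i.e. the $k$-th elementary symmetric function of the eigenvalues of the Hessian matrix $D^2u$. An absolutely continuous function $u=u(r)$ defined on $(0,1]$ is an integral radial solution of $S_k(D^2u)=g(u)$ in $B_1$ if $r^{n-1}g(u)\in L^1(0,1)$, $\int_0^1 r^{n-1}|u|^{k+1}\,dr<\infty$, $\int_0^1 r^{n-k}(u')^{k+1}\,dr<\infty$ and $$r^{n-k}(u')^k=c_{n,k}^{-1}\int_0^r s^{n-1}g(u)\,ds\quad\text{a.e. in }(0,1).$$ Here $u'$ is the derivative with respect to $r=|x|$, and $C^2(0,1]$ denotes the twice continuously differentiable functions on $(0,1]$.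
   Formalization: The condition that the integral of r^{n-k}(u')^{k+1} is finite is read as including that the integrand is nonnegative a.e., so u' ≥ 0 a.e. for even k; without it the claim fails (n=k=2, g=1, u'=r on (0,1/2), u'=-r on (1/2,1)). *)

theory Defs
  imports "HOL-Analysis.Analysis"
begin

text \<open>The usual epsilon-delta definition of absolute continuity. The finite families of
  non-overlapping compact intervals are the sets \<open>D\<close> with \<open>D division_of \<Union>D\<close>.\<close>

definition abs_continuous_on :: "real set \<Rightarrow> (real \<Rightarrow> real) \<Rightarrow> bool" where
  "abs_continuous_on S f \<longleftrightarrow>
     (\<forall>\<epsilon>>0. \<exists>\<delta>>0. \<forall>D. D division_of \<Union>D \<and> \<Union>D \<subseteq> S \<and> (\<Sum>I\<in>D. Sup I - Inf I) < \<delta>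
        \<longrightarrow> (\<Sum>I\<in>D. \<bar>f (Sup I) - f (Inf I)\<bar>) < \<epsilon>)"

text \<open>On the half-open interval \<open>(0,1]\<close> absolute continuity is understood locally, i.e. on every
  compact subinterval, so that \<open>u\<close> may be unbounded near \<open>0\<close>. Every function that satisfies the
  epsilon-delta condition on all of \<open>(0,1]\<close> is included.\<close>

definition abs_continuous_0_1 :: "(real \<Rightarrow> real) \<Rightarrow> bool" where
  "abs_continuous_0_1 u \<longleftrightarrow> (\<forall>a\<in>{0<..1}. abs_continuous_on {a..1} u)"

text \<open>The condition that the integral of \<open>f\<close> over \<open>S\<close> be less than \<open>\<infinity>\<close>, written without absolute
  values, is understood as usual for an integrand that is nonnegative a.e. For
  \<open>f r = r ^ (n - k) * (u' r) ^ (k + 1)\<close> with \<open>k\<close> even this says in particular \<open>u' \<ge> 0\<close> a.e.;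
  for odd \<open>k\<close> the nonnegativity is automatic.\<close>

definition finite_integral :: "real set \<Rightarrow> (real \<Rightarrow> real) \<Rightarrow> bool" where
  "finite_integral S f \<longleftrightarrow> (AE r\<in>S in lebesgue. 0 \<le> f r) \<and> f absolutely_integrable_on S"

definition hessian_const :: "nat \<Rightarrow> nat \<Rightarrow> real" where
  "hessian_const n k = real (n choose k) / real n"

text \<open>The values of \<open>u\<close> outside \<open>(0,1]\<close> play no role. Since \<open>deriv u r\<close> carries no information
  where \<open>u\<close> is not differentiable, the equation at \<open>r\<close> includes the existence of \<open>u'\<close> at \<open>r\<close>;
  for an absolutely continuous \<open>u\<close> this holds at almost every \<open>r\<close> by Lebesgue's theorem.\<close>

definition integral_radial_solution ::
  "nat \<Rightarrow> nat \<Rightarrow> (real \<Rightarrow> real) \<Rightarrow> (real \<Rightarrow> real) \<Rightarrow> bool" where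
  "integral_radial_solution n k g u \<longleftrightarrow>
     abs_continuous_0_1 u \<and>
     (\<lambda>r. r ^ (n - 1) * g (u r)) absolutely_integrable_on {0<..<1} \<and>
     finite_integral {0<..<1} (\<lambda>r. r ^ (n - 1) * \<bar>u r\<bar> ^ (k + 1)) \<and>
     finite_integral {0<..<1} (\<lambda>r. r ^ (n - k) * (deriv u r) ^ (k + 1)) \<and>
     (AE r\<in>{0<..<1} in lebesgue.
        u differentiable (at r) \<and>
        r ^ (n - k) * (deriv u r) ^ k =
          inverse (hessian_const n k) * (LINT s:{0<..<r}|lebesgue. s ^ (n - 1) * g (u s)))"

text \<open>Derivatives are taken within \<open>S\<close>, hence one-sided at an endpoint belonging to \<open>S\<close>.\<close>

definition C2_on :: "real set \<Rightarrow> (real \<Rightarrow> real) \<Rightarrow> bool" where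
  "C2_on S u \<longleftrightarrow>
     (\<exists>u' u''. (\<forall>r\<in>S. (u has_real_derivative u' r) (at r within S)) \<and>
               (\<forall>r\<in>S. (u' has_real_derivative u'' r) (at r within S)) \<and>
               continuous_on S u'')"

end

theory Submission
  imports Defs
begin

text \<open>Put \<open>F r = (\<integral> s \<in> (0,r). s ^ (n - 1) * g (u s))\<close>. Because \<open>g > 0\<close>, \<open>F\<close> is positive on
  \<open>(0,1]\<close>, so the equation forces \<open>u' \<noteq> 0\<close> almost everywhere; the nonnegativity of the energy
  density \<open>r ^ (n - k) * u' ^ (k + 1)\<close> then selects the positive \<open>k\<close>-th root, also for even \<open>k\<close>.
  Hence \<open>u' = w\<close> almost everywhere with \<open>w r = (F r / (c * r ^ (n - k))) powr (1 / k)\<close>, where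
  \<open>c = hessian_const n k\<close>.

  The right-hand side is smoother than \<open>u'\<close> was assumed to be. Being absolutely continuous, \<open>u\<close> is
  continuous on \<open>(0,1]\<close>, and so is the integrand of \<open>F\<close>; hence \<open>F\<close> is \<open>C\<^sup>1\<close> there. The base of the
  power is positive, so \<open>w\<close> is \<open>C\<^sup>1\<close> as well. It remains to replace almost everywhere by
  everywhere: an absolutely continuous function is recovered from its almost everywhere
  derivative by integration (\<open>abs_continuous_on_has_integral_derivative\<close>), so \<open>u\<close> is an
  antiderivative of the continuous function \<open>w\<close>. Thus \<open>u' = w\<close> on all of \<open>(0,1]\<close>, and \<open>u\<close> is
  \<open>C\<^sup>2\<close>.\<close>

section \<open>Absolutely continuous functions\<close>

lemma abs_continuous_on_subset:
  assumes "abs_continuous_on S f" "T \<subseteq> S"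
  shows "abs_continuous_on T f"
  using assms unfolding abs_continuous_on_def by (meson order_trans)

lemma abs_continuous_on_imp_continuous_on:
  fixes f :: "real \<Rightarrow> real"
  assumes ac: "abs_continuous_on {a..b} f"
  shows "continuous_on {a..b} f"
  unfolding continuous_on_iff
proof (intro ballI allI impI)
  fix x e :: real
  assume x: "x \<in> {a..b}" and "0 < e"
  then obtain d where "d > 0" and d: "\<And>D. D division_of \<Union>D \<Longrightarrow> \<Union>D \<subseteq> {a..b} \<Longrightarrow>
      (\<Sum>I\<in>D. Sup I - Inf I) < d \<Longrightarrow> (\<Sum>I\<in>D. \<bar>f (Sup I) - f (Inf I)\<bar>) < e"
    using ac unfolding abs_continuous_on_def by meson
  have small: "\<bar>f q - f p\<bar> < e" if "p \<le> q" "{p..q} \<subseteq> {a..b}" "q - p < d" for p q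
  proof -
    have "{{p..q}} division_of {p..q}"
      using division_of_self[of p q] that by simp
    then show ?thesis
      using d[of "{{p..q}}"] that by simp
  qed
  show "\<exists>d>0. \<forall>y\<in>{a..b}. dist y x < d \<longrightarrow> dist (f y) (f x) < e"
  proof (intro exI conjI ballI impI)
    fix y assume y: "y \<in> {a..b}" and "dist y x < d"
    then show "dist (f y) (f x) < e"
      using small[of x y] small[of y x] x
      by (cases "x \<le> y") (auto simp: dist_real_def abs_minus_commute)
  qed (fact \<open>d > 0\<close>)
qed

lemma sum_length_division_le_measure:
  fixes D :: "real set set"
  assumes D: "D division_of S" and sub: "S \<subseteq> T" and T: "T \<in> lmeasurable"
  shows "sum (measure lborel) D \<le> measure lebesgue T"
proof -
  have "((\<lambda>x. 1::real) has_integral sum (measure lborel) D) S"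
  proof (rule has_integral_combine_division[OF D])
    fix K assume "K \<in> D"
    then obtain u v where "K = cbox u v"
      using D by blast
    then show "((\<lambda>x. 1::real) has_integral measure lborel K) K"
      using has_integral_const[of "1::real" u v] by simp
  qed
  moreover have "((\<lambda>x. 1::real) has_integral measure lebesgue T) T"
    using T by (simp add: lmeasurable_iff_integrable_on lmeasure_integral integrable_integral)
  ultimately show ?thesis
    using has_integral_subset_le[OF sub] by simp
qed

text \<open>The errors at the two end points, measured from the tag \<open>x\<close>, add up to \<open>e\<close> times the length of
  the interval because \<open>x\<close> lies between them.\<close>

lemma increment_near_tag_le:
  fixes f :: "real \<Rightarrow> real"
  assumes "\<And>y. y \<in> {u..v} \<Longrightarrow> \<bar>f y - f x - f' * (y - x)\<bar> \<le> e * \<bar>y - x\<bar>"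
    and "x \<in> {u..v}"
  shows "\<bar>(v - u) * f' - (f v - f u)\<bar> \<le> e * (v - u)"
proof -
  have "\<bar>f u - f x - f' * (u - x)\<bar> \<le> e * (x - u)" "\<bar>f v - f x - f' * (v - x)\<bar> \<le> e * (v - x)"
    using assms(1)[of u] assms(1)[of v] assms(2) by auto
  then show ?thesis
    unfolding abs_le_iff by (simp add: algebra_simps)
qed

text \<open>The fundamental theorem of calculus for absolutely continuous functions. A Riemann sum is split
  by its tags: at tags outside the null set \<open>N\<close> differentiability controls the error by the length of
  the interval, whereas the intervals tagged in \<open>N\<close> lie in an open set of small measure, where
  absolute continuity controls the total increment of \<open>f\<close>.\<close>

lemma abs_continuous_on_has_integral_derivative:
  fixes f f' :: "real \<Rightarrow> real"
  assumes "a \<le> b"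
    and ac: "abs_continuous_on {a..b} f"
    and N: "negligible N"
    and deriv: "\<And>x. x \<in> {a..b} - N \<Longrightarrow> (f has_real_derivative f' x) (at x within {a..b})"
  shows "(f' has_integral (f b - f a)) {a..b}"
proof -
  \<comment> \<open>With the value \<open>0\<close> on \<open>N\<close>, the terms tagged in \<open>N\<close> drop out of the Riemann sums.\<close>
  define h where "h x = (if x \<in> N then 0 else f' x)" for x
  have "(h has_integral (f b - f a)) (cbox a b)"
    unfolding has_integral
  proof (intro allI impI)
    fix e :: real assume "e > 0"
    \<comment> \<open>The summand \<open>1\<close> keeps the denominator positive when \<open>a = b\<close>.\<close>
    define e1 where "e1 = e / (2 * (b - a + 1))"
    have "e1 > 0" and e1: "e1 * (b - a) < e / 2"
      using \<open>e > 0\<close> \<open>a \<le> b\<close> by (auto simp: e1_def field_simps)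
    obtain d where "d > 0" and d: "\<And>D. D division_of \<Union>D \<Longrightarrow> \<Union>D \<subseteq> {a..b} \<Longrightarrow>
        (\<Sum>I\<in>D. Sup I - Inf I) < d \<Longrightarrow> (\<Sum>I\<in>D. \<bar>f (Sup I) - f (Inf I)\<bar>) < e / 2"
      using ac \<open>e > 0\<close> unfolding abs_continuous_on_def by (meson half_gt_zero)
    have "N \<in> sets lebesgue" "N \<in> null_sets lebesgue"
      using N by (auto simp: negligible_iff_null_sets)
    then obtain U where "open U" "N \<subseteq> U" and U_N: "U - N \<in> lmeasurable"
      and "emeasure lebesgue (U - N) < ennreal d"
      using sets_lebesgue_outer_open[of N d] \<open>d > 0\<close> by blast
    then have "measure lebesgue (U - N) < d"
      using emeasure_eq_measure2[OF U_N] \<open>d > 0\<close> by (simp add: ennreal_less_iff)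
    moreover have "(U - N) \<union> N = U"
      using \<open>N \<subseteq> U\<close> by blast
    ultimately have U: "U \<in> lmeasurable" "measure lebesgue U < d"
      using fmeasurable.Un[OF U_N negligible_imp_measurable[OF N]]
        measure_Un_null_set[OF fmeasurableD[OF U_N] \<open>N \<in> null_sets lebesgue\<close>]
      by metis+
    have "\<exists>s>0. (x \<in> N \<longrightarrow> ball x s \<subseteq> U) \<and>
        (x \<in> {a..b} - N \<longrightarrow> (\<forall>y\<in>{a..b}. \<bar>y - x\<bar> < s \<longrightarrow>
          \<bar>f y - f x - f' x * (y - x)\<bar> \<le> e1 * \<bar>y - x\<bar>))" for x
    proof (cases "x \<in> N")
      case True
      then show ?thesis
        using \<open>open U\<close> \<open>N \<subseteq> U\<close> open_contains_ball by blast
    next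
      case False
      show ?thesis
      proof (cases "x \<in> {a..b}")
        case True
        with False have "(f has_derivative (\<lambda>t. f' x * t)) (at x within {a..b})"
          using deriv by (simp add: has_field_derivative_def)
        then show ?thesis
          using False \<open>e1 > 0\<close> unfolding has_derivative_within_alt by auto
      next
        case False
        with \<open>x \<notin> N\<close> show ?thesis
          by (intro exI[of _ 1]) auto
      qed
    qed
    then obtain s where s: "\<And>x. s x > 0" "\<And>x. x \<in> N \<Longrightarrow> ball x (s x) \<subseteq> U"
      "\<And>x y. x \<in> {a..b} - N \<Longrightarrow> y \<in> {a..b} \<Longrightarrow> \<bar>y - x\<bar> < s x \<Longrightarrow>
          \<bar>f y - f x - f' x * (y - x)\<bar> \<le> e1 * \<bar>y - x\<bar>"
      by metis
    show "\<exists>\<gamma>. gauge \<gamma> \<and> (\<forall>p. p tagged_division_of cbox a b \<and> \<gamma> fine p \<longrightarrow>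
        norm ((\<Sum>(x, K)\<in>p. measure lborel K *\<^sub>R h x) - (f b - f a)) < e)"
    proof (intro exI conjI allI impI)
      show "gauge (\<lambda>x. ball x (s x))"
        using s(1) gauge_ball_dependent by blast
      fix p assume "p tagged_division_of cbox a b \<and> (\<lambda>x. ball x (s x)) fine p"
      then have p: "p tagged_division_of cbox a b" and fine: "(\<lambda>x. ball x (s x)) fine p"
        by auto
      have "finite p"
        using p by (rule tagged_division_ofD(1))
      have elem: "\<exists>u v. K = {u..v} \<and> u \<le> v \<and> x \<in> {u..v} \<and> {u..v} \<subseteq> {a..b} \<and> {u..v} \<subseteq> ball x (s x)"
        if xK: "(x, K) \<in> p" for x K
      proof -
        obtain u v where K: "K = cbox u v"
          using tagged_division_ofD(4)[OF p xK] by blast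
        moreover have "x \<in> K" "K \<subseteq> cbox a b"
          using tagged_division_ofD(2,3)[OF p xK] by auto
        moreover have "K \<subseteq> ball x (s x)"
          using fine xK by (auto simp: fine_def)
        ultimately show ?thesis by auto
      qed
      define pN where "pN = {(x, K) \<in> p. x \<in> N}"
      have pN: "pN \<subseteq> p"
        by (auto simp: pN_def)
      have pN_part: "pN tagged_partial_division_of cbox a b"
        using p by (intro tagged_partial_division_subset[OF _ pN]) (simp add: tagged_division_of_def)
      define D where "D = snd ` pN"
      have D: "D division_of \<Union>D"
        unfolding D_def by (rule partial_division_of_tagged_division[OF pN_part])
      have D_tagged: "(\<exists>u v. I = {u..v} \<and> u \<le> v) \<and> I \<subseteq> {a..b} \<and> I \<subseteq> U"
        if "I \<in> D" for I
      proof -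
        obtain x where "(x, I) \<in> p" "x \<in> N"
          using \<open>I \<in> D\<close> by (auto simp: D_def pN_def)
        with elem[of x I] s(2)[of x] show ?thesis by blast
      qed
      have "(\<Sum>I\<in>D. Sup I - Inf I) = sum (measure lborel) D"
      proof (rule sum.cong)
        fix I assume "I \<in> D"
        then obtain u v where "I = {u..v}" "u \<le> v"
          using D_tagged by meson
        then show "Sup I - Inf I = measure lborel I" by simp
      qed simp
      also have "\<dots> \<le> measure lebesgue U"
        using D_tagged by (intro sum_length_division_le_measure[OF D _ U(1)] Union_least) simp
      finally have "(\<Sum>I\<in>D. Sup I - Inf I) < d"
        using U(2) by simp
      moreover have "\<Union>D \<subseteq> {a..b}"
        using D_tagged by (intro Union_least) simp
      ultimately have "(\<Sum>I\<in>D. \<bar>f (Sup I) - f (Inf I)\<bar>) < e / 2"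
        by (intro d[OF D])
      moreover have "(\<Sum>(x, K)\<in>pN. \<bar>measure lborel K * h x - (f (Sup K) - f (Inf K))\<bar>)
          = (\<Sum>I\<in>D. \<bar>f (Sup I) - f (Inf I)\<bar>)"
      proof -
        \<comment> \<open>\<open>Sup\<close> and \<open>Inf\<close> of the empty set are unspecified, so it is treated separately.\<close>
        define inc where "inc K = (if K = {} then 0 else \<bar>f (Sup K) - f (Inf K)\<bar>)" for K
        have "\<bar>measure lborel K * h x - (f (Sup K) - f (Inf K))\<bar> = inc K" if "(x, K) \<in> pN" for x K
        proof -
          have "(x, K) \<in> p" "h x = 0"
            using that by (auto simp: pN_def h_def)
          moreover have "K \<noteq> {}"
            using elem[OF \<open>(x, K) \<in> p\<close>] by auto
          ultimately show ?thesis
            by (simp add: inc_def)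
        qed
        then have "(\<Sum>(x, K)\<in>pN. \<bar>measure lborel K * h x - (f (Sup K) - f (Inf K))\<bar>)
            = (\<Sum>(x, K)\<in>pN. inc K)"
          by (intro sum.cong) auto
        \<comment> \<open>The same interval may carry two tags, but only if it is degenerate, and then \<open>inc\<close> is \<open>0\<close>.\<close>
        also have "\<dots> = sum inc D"
          unfolding D_def
        proof (rule sum.over_tagged_division_lemma[OF tagged_partial_division_of_Union_self[OF pN_part]])
          fix u v :: real assume "box u v = {}"
          then show "inc (cbox u v) = 0"
            by (cases "u = v") (auto simp: inc_def)
        qed
        also have "\<dots> = (\<Sum>I\<in>D. \<bar>f (Sup I) - f (Inf I)\<bar>)"
        proof (rule sum.cong)
          fix I assume "I \<in> D"
          then obtain u v where "I = {u..v}" "u \<le> v"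
            using D_tagged by meson
          then show "inc I = \<bar>f (Sup I) - f (Inf I)\<bar>" by (simp add: inc_def)
        qed simp
        finally show ?thesis .
      qed
      ultimately have bad: "(\<Sum>(x, K)\<in>pN. \<bar>measure lborel K * h x - (f (Sup K) - f (Inf K))\<bar>) < e / 2"
        by simp
      have "(\<Sum>(x, K)\<in>p - pN. \<bar>measure lborel K * h x - (f (Sup K) - f (Inf K))\<bar>)
          \<le> (\<Sum>(x, K)\<in>p - pN. e1 * (Sup K - Inf K))"
      proof (intro sum_mono, clarify)
        fix x K assume xK: "(x, K) \<in> p" "(x, K) \<notin> pN"
        then obtain u v where K: "K = {u..v}" "u \<le> v" "x \<in> {u..v}" "{u..v} \<subseteq> {a..b}"
          "{u..v} \<subseteq> ball x (s x)"
          using elem by meson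
        have "x \<in> {a..b} - N"
          using xK K by (auto simp: pN_def)
        moreover have "\<bar>y - x\<bar> < s x" if "y \<in> {u..v}" for y
          using K(5) that by (auto simp: dist_real_def abs_minus_commute)
        ultimately have "\<bar>(v - u) * f' x - (f v - f u)\<bar> \<le> e1 * (v - u)"
          using K(4) by (intro increment_near_tag_le[OF _ K(3)] s(3)) auto
        then show "\<bar>measure lborel K * h x - (f (Sup K) - f (Inf K))\<bar> \<le> e1 * (Sup K - Inf K)"
          using K \<open>x \<in> {a..b} - N\<close> by (simp add: h_def)
      qed
      also have "\<dots> \<le> (\<Sum>(x, K)\<in>p. e1 * (Sup K - Inf K))"
      proof (rule sum_mono2[OF \<open>finite p\<close>])
        fix i assume "i \<in> p - (p - pN)"
        then show "0 \<le> (case i of (x, K) \<Rightarrow> e1 * (Sup K - Inf K))"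
          using elem[of "fst i" "snd i"] \<open>e1 > 0\<close> by (auto simp: case_prod_beta)
      qed auto
      also have "\<dots> = e1 * (b - a)"
        using additive_tagged_division_1[where f = "\<lambda>x. x", OF \<open>a \<le> b\<close>] p
        by (simp add: sum_distrib_left[symmetric] case_prod_beta)
      finally have good: "(\<Sum>(x, K)\<in>p - pN. \<bar>measure lborel K * h x - (f (Sup K) - f (Inf K))\<bar>) < e / 2"
        using e1 by simp
      have "(\<Sum>(x, K)\<in>p. measure lborel K *\<^sub>R h x) - (f b - f a)
          = (\<Sum>(x, K)\<in>p. measure lborel K * h x - (f (Sup K) - f (Inf K)))"
        using additive_tagged_division_1[where f = f, OF \<open>a \<le> b\<close>] p
        by (simp add: sum_subtractf case_prod_beta)
      also have "\<bar>\<dots>\<bar> \<le> (\<Sum>(x, K)\<in>p. \<bar>measure lborel K * h x - (f (Sup K) - f (Inf K))\<bar>)"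
        using sum_abs[of "\<lambda>(x, K). measure lborel K * h x - (f (Sup K) - f (Inf K))" p]
        by (simp add: case_prod_beta)
      also have "\<dots> < e"
        using good bad sum.subset_diff[OF pN \<open>finite p\<close>,
            of "\<lambda>(x, K). \<bar>measure lborel K * h x - (f (Sup K) - f (Inf K))\<bar>"] by simp
      finally show "norm ((\<Sum>(x, K)\<in>p. measure lborel K *\<^sub>R h x) - (f b - f a)) < e"
        by simp
    qed
  qed
  then show ?thesis
    using has_integral_spike[OF N, of "{a..b}" f' h] by (auto simp: h_def)
qed

section \<open>Indefinite integrals on the half-open unit interval\<close>

text \<open>Derivatives on \<open>(0,1]\<close> are obtained from integrals that start at a positive base point;
  differentiability being local, one may let that point depend on \<open>r\<close>.\<close>

lemma DERIV_Ioc_if_Icc: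
  fixes f :: "real \<Rightarrow> real"
  assumes "\<And>a. 0 < a \<Longrightarrow> a < r \<Longrightarrow> (f has_real_derivative D) (at r within {a..1})"
    and "0 < r"
  shows "(f has_real_derivative D) (at r within {0<..1})"
proof -
  have "at r within {0<..1} = at r within {r/2..1}"
    by (rule at_within_nhd[of r "{r/2<..}"]) (use \<open>0 < r\<close> in auto)
  then show ?thesis
    using assms(1)[of "r/2"] \<open>0 < r\<close> by simp
qed

lemma DERIV_indefinite_integral_Ioc:
  fixes G :: "real \<Rightarrow> real"
  assumes int: "G integrable_on {0..1}" and cont: "continuous_on {0<..1} G" and r: "r \<in> {0<..1}"
  shows "((\<lambda>r. integral {0..r} G) has_real_derivative G r) (at r within {0<..1})"
proof (rule DERIV_Ioc_if_Icc)
  fix a :: real assume a: "0 < a" "a < r"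
  have "((\<lambda>t. integral {0..a} G + integral {a..t} G) has_real_derivative 0 + G r)
      (at r within {a..1})"
    using a r
    by (intro DERIV_add DERIV_const integral_has_real_derivative continuous_on_subset[OF cont]) auto
  then have "((\<lambda>t. integral {0..t} G) has_real_derivative 0 + G r) (at r within {a..1})"
  proof (rule has_field_derivative_transform_within[OF _ zero_less_one])
    show "integral {0..a} G + integral {a..t} G = integral {0..t} G" if "t \<in> {a..1}" for t
      using that a
      by (intro Henstock_Kurzweil_Integration.integral_combine
          integrable_on_subinterval[OF int]) auto
  qed (use a r in auto)
  then show "((\<lambda>t. integral {0..t} G) has_real_derivative G r) (at r within {a..1})"
    by simp
qed (use r in auto)

lemma integral_from_0_pos:
  fixes G :: "real \<Rightarrow> real"
  assumes int: "G integrable_on {0..1}" and cont: "continuous_on {0<..1} G"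
    and pos: "\<And>s. 0 < s \<Longrightarrow> 0 < G s" and r: "0 < r" "r \<le> 1"
  shows "0 < integral {0..r} G"
proof -
  have "integral {0<..<r/2} G \<ge> 0"
    using pos
    by (intro integral_nonneg) (use integrable_on_subinterval[OF int, of 0 "r/2"] r pos in
        \<open>auto simp: integrable_on_Icc_iff_Ioo less_imp_le\<close>)
  then have "integral {0..r/2} G \<ge> 0"
    by (simp add: integral_open_interval_real)
  moreover have "integral {r/2..r} (\<lambda>_. 0) < integral {r/2..r} G"
    using r pos by (intro integral_less_real continuous_on_subset[OF cont]) auto
  moreover have "integral {0..r/2} G + integral {r/2..r} G = integral {0..r} G"
    using r by (intro Henstock_Kurzweil_Integration.integral_combine
        integrable_on_subinterval[OF int]) auto
  ultimately show ?thesis by simp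
qed

section \<open>Regularity of integral radial solutions\<close>

text \<open>The positive \<open>k\<close>-th root is the right one: \<open>x ^ k > 0\<close> alone leaves the sign of \<open>x\<close> open for
  even \<open>k\<close>, and then \<open>x ^ (k + 1)\<close> has the sign of \<open>x\<close>.\<close>

lemma eq_powr_inverse_if_power_eq:
  fixes x q :: real
  assumes "x ^ k = q" "0 < q" "0 \<le> x ^ (k + 1)" "1 \<le> k"
  shows "x = q powr (1 / real k)"
proof -
  have "0 \<le> x"
    using assms(1,2,3) by (simp add: zero_le_mult_iff)
  moreover have "x \<noteq> 0"
    using assms(1,2,4) by (auto simp: zero_power)
  ultimately have "0 < x" by simp
  then have "q = x powr real k"
    using assms(1) by (simp add: powr_realpow)
  then show ?thesis
    using \<open>0 < x\<close> assms(4) by (simp add: powr_powr)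
qed

theorem corollary1p7:
  fixes n k :: nat and g u :: "real \<Rightarrow> real"
  assumes "1 \<le> n" and "1 \<le> k" and "k \<le> n"
    and "\<And>t. 0 < g t" and "g C1_differentiable_on UNIV"
    and "integral_radial_solution n k g u"
  shows "C2_on {0<..1} u"
proof -
  define G where "G s = s ^ (n - 1) * g (u s)" for s
  define F where "F r = integral {0..r} G" for r
  define c where "c = hessian_const n k"
  define m where "m = n - k"
  define Q where "Q r = F r / (c * r ^ m)" for r
  define w where "w r = Q r powr (1 / real k)" for r

  have "0 < c"
    using assms(1,3) by (simp add: c_def hessian_const_def zero_less_binomial)
  have ac: "abs_continuous_on {a..1} u" if "0 < a" "a \<le> 1" for a
    using assms(6) that by (simp add: integral_radial_solution_def abs_continuous_0_1_def)
  have u_cont: "continuous_on {0<..1} u"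
    unfolding continuous_on_eq_continuous_within
  proof
    fix r :: real assume r: "r \<in> {0<..1}"
    have "at r within {0<..1} = at r within {r/2..1}"
      by (rule at_within_nhd[of r "{r/2<..}"]) (use r in auto)
    then show "continuous (at r within {0<..1}) u"
      using abs_continuous_on_imp_continuous_on[OF ac[of "r/2"]] r
      by (simp add: continuous_on_eq_continuous_within)
  qed
  have g_cont: "continuous_on UNIV g"
    using assms(5) by (rule C1_differentiable_imp_continuous_on)
  have G_cont: "continuous_on {0<..1} G"
    unfolding G_def
    by (intro continuous_intros continuous_on_compose2[OF g_cont u_cont]) auto
  have G_pos: "0 < G s" if "0 < s" for s
    using assms(4) that by (simp add: G_def)
  have G_abs: "G absolutely_integrable_on {0<..<1}"
    using assms(6) by (simp add: integral_radial_solution_def G_def[abs_def])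
  have G_int: "G integrable_on {0..1}"
    using set_lebesgue_integral_eq_integral(1)[OF G_abs] by (simp add: integrable_on_Icc_iff_Ioo)

  have F_deriv: "(F has_real_derivative G r) (at r within {0<..1})" if "r \<in> {0<..1}" for r
    unfolding F_def[abs_def] by (rule DERIV_indefinite_integral_Ioc[OF G_int G_cont that])
  have F_pos: "0 < F r" if "r \<in> {0<..1}" for r
    unfolding F_def using that by (intro integral_from_0_pos[OF G_int G_cont G_pos]) auto
  have F_cont: "continuous_on {0<..1} F"
    using F_deriv by (rule DERIV_continuous_on)
  have Q_pos: "0 < Q r" if "r \<in> {0<..1}" for r
    using F_pos[OF that] \<open>0 < c\<close> that by (simp add: Q_def)
  have Q_cont: "continuous_on {0<..1} Q"
    unfolding Q_def[abs_def] using \<open>0 < c\<close> by (intro continuous_intros F_cont) auto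
  have w_cont: "continuous_on {0<..1} w"
    unfolding w_def[abs_def] by (intro continuous_intros Q_cont) (use Q_pos in force)

  have "AE r in lebesgue. r \<in> {0<..<1} \<longrightarrow> (u has_real_derivative w r) (at r)"
  proof -
    have "AE r\<in>{0<..<1} in lebesgue. 0 \<le> r ^ m * (deriv u r) ^ (k + 1)"
      and "AE r\<in>{0<..<1} in lebesgue. u differentiable (at r) \<and>
        r ^ m * (deriv u r) ^ k = inverse c * (LINT s:{0<..<r}|lebesgue. G s)"
      using assms(6)
      by (auto simp: integral_radial_solution_def finite_integral_def m_def c_def G_def)
    then show ?thesis
    proof eventually_elim
      case (elim r)
      show ?case
      proof
        assume r: "r \<in> {0<..<1}"
        have "set_integrable lebesgue {0<..<r} G"
          by (rule set_integrable_subset[OF G_abs]) (use r in auto)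
        then have "(LINT s:{0<..<r}|lebesgue. G s) = F r"
          by (simp add: set_lebesgue_integral_eq_integral(2) F_def integral_open_interval_real)
        then have "(deriv u r) ^ k = Q r"
          using elim r \<open>0 < c\<close> by (simp add: Q_def field_simps)
        moreover have "0 \<le> (deriv u r) ^ (k + 1)"
        proof -
          have "0 \<le> r ^ m * (deriv u r) ^ (k + 1)" "0 < r ^ m"
            using elim(1) r by simp_all
          then show ?thesis
            by (metis zero_le_mult_iff not_le)
        qed
        ultimately have "deriv u r = w r"
          unfolding w_def using Q_pos r assms(2)
          by (intro eq_powr_inverse_if_power_eq) auto
        moreover have "(u has_real_derivative deriv u r) (at r)"
          using elim(2) r by (simp add: DERIV_deriv_iff_real_differentiable)
        ultimately show "(u has_real_derivative w r) (at r)"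
          by simp
      qed
    qed
  qed
  then obtain N where "N \<in> null_sets lebesgue"
    and "{r. \<not> (r \<in> {0<..<1} \<longrightarrow> (u has_real_derivative w r) (at r))} \<subseteq> N"
    unfolding eventually_ae_filter by auto
  \<comment> \<open>The equation holds inside \<open>(0,1)\<close> only, so the end point \<open>1\<close> is put into the null set.\<close>
  then have N: "negligible (insert 1 N)"
    and u_deriv_ae: "\<And>r. r \<in> {0<..1} - insert 1 N \<Longrightarrow> (u has_real_derivative w r) (at r)"
    by (auto simp: negligible_iff_null_sets[symmetric])

  have u_deriv: "(u has_real_derivative w r) (at r within {0<..1})" if r: "r \<in> {0<..1}" for r
  proof (rule DERIV_Ioc_if_Icc)
    fix a :: real assume a: "0 < a" "a < r"
    have u_eq: "u a + integral {a..t} w = u t" if t: "t \<in> {a..1}" for t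
    proof -
      have "(w has_integral (u t - u a)) {a..t}"
      proof (rule abs_continuous_on_has_integral_derivative[OF _ _ N])
        show "abs_continuous_on {a..t} u"
          by (rule abs_continuous_on_subset[OF ac[of a]]) (use a r t in auto)
      next
        fix x assume "x \<in> {a..t} - insert 1 N"
        then show "(u has_real_derivative w x) (at x within {a..t})"
          using a t by (intro has_field_derivative_at_within[OF u_deriv_ae]) auto
      qed (use t in auto)
      then show ?thesis
        by (simp add: integral_unique)
    qed
    have "((\<lambda>t. u a + integral {a..t} w) has_real_derivative 0 + w r) (at r within {a..1})"
      using a r
      by (intro DERIV_add DERIV_const integral_has_real_derivative continuous_on_subset[OF w_cont])
        auto
    then have "(u has_real_derivative 0 + w r) (at r within {a..1})"
      by (rule has_field_derivative_transform_within[OF _ zero_less_one]) (use a r u_eq in auto)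
    then show "(u has_real_derivative w r) (at r within {a..1})"
      by simp
  qed (use r in auto)

  define Q' where "Q' r = (G r * (c * r ^ m) - F r * (c * (real m * r ^ (m - 1))))
    / ((c * r ^ m) * (c * r ^ m))" for r
  define w' where "w' r = 1 / real k * Q r powr (1 / real k - 1) * Q' r" for r
  have Q_deriv: "(Q has_real_derivative Q' r) (at r within {0<..1})" if "r \<in> {0<..1}" for r
    unfolding Q_def[abs_def] Q'_def using that \<open>0 < c\<close>
    by (auto intro!: derivative_eq_intros F_deriv)
  have w_deriv: "(w has_real_derivative w' r) (at r within {0<..1})" if "r \<in> {0<..1}" for r
    using DERIV_chain2[OF has_real_derivative_powr[OF Q_pos[OF that], of "1 / real k"] Q_deriv[OF that]]
    by (simp add: w_def[abs_def] w'_def)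
  have "continuous_on {0<..1} Q'"
    unfolding Q'_def[abs_def] using \<open>0 < c\<close> by (intro continuous_intros F_cont G_cont) auto
  then have "continuous_on {0<..1} w'"
    unfolding w'_def[abs_def] by (intro continuous_intros Q_cont) (use Q_pos in force)
  with u_deriv w_deriv show ?thesis
    unfolding C2_on_def by (intro exI[of _ w] exI[of _ w']) simp
qed

end
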